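(* Let $n\ge 1$ be an integer and let $\mathcal{SG}_n$ be the set of subdiagonal general lattice paths from $(0,0)$ to $(n,n)$. Then the parameter "active set" restricted to $\mathcal{SG}_n$ is uniformly distributed over all subsets of $[n-1]=\{1,2,\ldots,n-1\}$: for every subset $S\subseteq[n-1]$, the number of paths $\pi\in\mathcal{SG}_n$ whose active set equals $S$ is the same (i.e. independent of $S$).
   Context: A general lattice path is a finite sequence of steps, each step lying in $\mathbb{N}\times\mathbb{N}\setminus\{(0,0)\}$ (i.e. $(i,j)$ with $i,j$ nonnegative integers not both $0$). A path starting at $(0,0)$ has as vertices $(0,0)$ and the successive partial sums of its steps; consecutive vertices are joined by line segments. A subpath of a path $\pi$ is a subsequence of consecutive steps of $\pi$ (so it starts at some vertex of $\pi$ and ends at a later vertex); it is nonempty if it has at least one step. A path is balanced if its terminal vertex lies on the line of slope $1$ through its initial vertex. A path is subdiagonal if it never rises above the line of slope $1$ through its initial vertex, and superdiagonal if it never falls below the line of slope $1$ through its initial vertex. Thus $\mathcal{SG}_n$ consists of the general lattice paths from $(0,0)$ to $(n,n)$ never rising above $y=x$. For such a path $\pi$ and $1\le k\le n-1$, the vertical line $x=k$ is active for $\pi$ if it contains a vertex $V$ of $\pi$ such that (i) $V$ lies on the line $y=x$, or (ii) $V$ lies strictly below $y=x$ and $V$ is the initial vertex of a nonempty balanced subdiagonal subpath of $\pi$, or (iii) $V$ lies strictly above $y=x$ and $V$ is the terminal vertex of a nonempty balanced superdiagonal subpath of $\pi$. The active set of $\pi$ is $\{k\in[n-1]: x=k \text{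 is active for } \pi\}$. *)

theory Defs
  imports "HOL-Analysis.Analysis"
begin

type_synonym point = "nat \<times> nat"

text \<open>A path is given by its list of steps together with the initial vertex \<open>p\<close>, which is passed
  separately, so that a subpath keeps its position in the plane.\<close>

definition general_steps :: "point list \<Rightarrow> bool" where
  "general_steps \<pi> \<longleftrightarrow> (0, 0) \<notin> set \<pi>"

definition vertex :: "point \<Rightarrow> point list \<Rightarrow> nat \<Rightarrow> point" where
  "vertex p \<pi> i = p + sum_list (take i \<pi>)"

definition real_point :: "point \<Rightarrow> real \<times> real" where
  "real_point v = (real (fst v), real (snd v))"

definition path_trace :: "point \<Rightarrow> point list \<Rightarrow> (real \<times> real) set" where
  "path_trace p \<pi> = insert (real_point p)
     (\<Union>i<length \<pi>. closed_segment (real_point (vertex p \<pi> i)) (real_point (vertex p \<pi> (Suc i))))"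

definition balanced :: "point \<Rightarrow> point list \<Rightarrow> bool" where
  "balanced p \<pi> \<longleftrightarrow>
     (case real_point (vertex p \<pi> (length \<pi>)) of (x, y) \<Rightarrow> y - real (snd p) = x - real (fst p))"

definition subdiagonal :: "point \<Rightarrow> point list \<Rightarrow> bool" where
  "subdiagonal p \<pi> \<longleftrightarrow> (\<forall>(x, y) \<in> path_trace p \<pi>. y - real (snd p) \<le> x - real (fst p))"

definition superdiagonal :: "point \<Rightarrow> point list \<Rightarrow> bool" where
  "superdiagonal p \<pi> \<longleftrightarrow> (\<forall>(x, y) \<in> path_trace p \<pi>. y - real (snd p) \<ge> x - real (fst p))"

text \<open>The steps leading from vertex number \<open>i\<close> to vertex number \<open>j\<close>.\<close>

definition substeps :: "point list \<Rightarrow> nat \<Rightarrow> nat \<Rightarrow> point list" where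
  "substeps \<pi> i j = take (j - i) (drop i \<pi>)"

definition SG :: "nat \<Rightarrow> point list set" where
  "SG n = {\<pi>. general_steps \<pi> \<and> vertex (0, 0) \<pi> (length \<pi>) = (n, n) \<and> subdiagonal (0, 0) \<pi>}"

definition active_vertex :: "point list \<Rightarrow> nat \<Rightarrow> bool" where
  "active_vertex \<pi> i \<longleftrightarrow>
     (let v = vertex (0, 0) \<pi> in
        snd (v i) = fst (v i) \<or>
        (snd (v i) < fst (v i) \<and>
          (\<exists>j. i < j \<and> j \<le> length \<pi> \<and>
             balanced (v i) (substeps \<pi> i j) \<and> subdiagonal (v i) (substeps \<pi> i j))) \<or>
        (snd (v i) > fst (v i) \<and>
          (\<exists>j<i. balanced (v j) (substeps \<pi> j i) \<and> superdiagonal (v j) (substeps \<pi> j i))))"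

definition active_line :: "point list \<Rightarrow> nat \<Rightarrow> bool" where
  "active_line \<pi> k \<longleftrightarrow> (\<exists>i\<le>length \<pi>. fst (vertex (0, 0) \<pi> i) = k \<and> active_vertex \<pi> i)"

definition active_set :: "nat \<Rightarrow> point list \<Rightarrow> nat set" where
  "active_set n \<pi> = {k \<in> {1..n - 1}. active_line \<pi> k}"

text \<open>By convexity, being on one side of a line only has to be checked at the vertices.\<close>

lemma path_trace_subset_convex_iff:
  assumes "convex C"
  shows "path_trace p \<pi> \<subseteq> C \<longleftrightarrow> (\<forall>i\<le>length \<pi>. real_point (vertex p \<pi> i) \<in> C)"
proof
  assume sub: "path_trace p \<pi> \<subseteq> C"
  show "\<forall>i\<le>length \<pi>. real_point (vertex p \<pi> i) \<in> C"
  proof (intro allI impI)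
    fix i assume i: "i \<le> length \<pi>"
    have "real_point (vertex p \<pi> i) \<in> path_trace p \<pi>"
    proof (cases i)
      case 0
      then show ?thesis by (simp add: path_trace_def vertex_def)
    next
      case (Suc m)
      then have "m < length \<pi>" using i by simp
      then show ?thesis unfolding path_trace_def Suc by blast
    qed
    then show "real_point (vertex p \<pi> i) \<in> C" using sub by blast
  qed
next
  assume v: "\<forall>i\<le>length \<pi>. real_point (vertex p \<pi> i) \<in> C"
  have "real_point p \<in> C" using v[rule_format, of 0] by (simp add: vertex_def)
  moreover have "closed_segment (real_point (vertex p \<pi> i)) (real_point (vertex p \<pi> (Suc i))) \<subseteq> C"
    if "i < length \<pi>" for i
    using that v assms by (intro closed_segment_subset) auto
  ultimately show "path_trace p \<pi> \<subseteq> C" unfolding path_trace_def by blast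
qed

lemma convex_below: "convex {(x, y). y - b \<le> x - (a::real)}"
proof -
  have "{(x, y). y - b \<le> x - a} = {z. inner (- 1, 1) z \<le> b - a}"
    by (auto simp: inner_prod_def)
  then show ?thesis using convex_halfspace_le by metis
qed

lemma convex_above: "convex {(x, y). y - b \<ge> x - (a::real)}"
proof -
  have "{(x, y). y - b \<ge> x - a} = {z. inner (- 1, 1) z \<ge> b - a}"
    by (auto simp: inner_prod_def)
  then show ?thesis using convex_halfspace_ge by metis
qed

lemma subdiagonal_iff:
  "subdiagonal p \<pi> \<longleftrightarrow>
     (\<forall>i\<le>length \<pi>. snd (vertex p \<pi> i) + fst p \<le> fst (vertex p \<pi> i) + snd p)"
proof -
  have "subdiagonal p \<pi> \<longleftrightarrow> path_trace p \<pi> \<subseteq> {(x, y). y - real (snd p) \<le> x - real (fst p)}"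
    by (auto simp: subdiagonal_def)
  also have "\<dots> \<longleftrightarrow> (\<forall>i\<le>length \<pi>. snd (vertex p \<pi> i) + fst p \<le> fst (vertex p \<pi> i) + snd p)"
    by (subst path_trace_subset_convex_iff[OF convex_below]) (auto simp: real_point_def)
  finally show ?thesis .
qed

lemma superdiagonal_iff:
  "superdiagonal p \<pi> \<longleftrightarrow>
     (\<forall>i\<le>length \<pi>. snd (vertex p \<pi> i) + fst p \<ge> fst (vertex p \<pi> i) + snd p)"
proof -
  have "superdiagonal p \<pi> \<longleftrightarrow> path_trace p \<pi> \<subseteq> {(x, y). y - real (snd p) \<ge> x - real (fst p)}"
    by (auto simp: superdiagonal_def)
  also have "\<dots> \<longleftrightarrow> (\<forall>i\<le>length \<pi>. snd (vertex p \<pi> i) + fst p \<ge> fst (vertex p \<pi> i) + snd p)"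
    by (subst path_trace_subset_convex_iff[OF convex_above]) (auto simp: real_point_def)
  finally show ?thesis .
qed

lemma balanced_iff:
  "balanced p \<pi> \<longleftrightarrow>
     snd (vertex p \<pi> (length \<pi>)) + fst p = fst (vertex p \<pi> (length \<pi>)) + snd p"
  by (auto simp: balanced_def real_point_def)

text \<open>Finiteness ensures that cardinalities of sets of such paths are genuine counts.\<close>

lemma general_steps_bounds:
  assumes "general_steps \<pi>"
  shows "length \<pi> \<le> fst (sum_list \<pi>) + snd (sum_list \<pi>) \<and>
    set \<pi> \<subseteq> {..fst (sum_list \<pi>)} \<times> {..snd (sum_list \<pi>)}"
  using assms
proof (induction \<pi>)
  case Nil
  then show ?case by simp
next
  case (Cons s \<pi>)
  obtain a b where s: "s = (a, b)" by force
  have "a + b \<ge> 1" using Cons.prems unfolding general_steps_def s by (cases a; cases b) auto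
  then show ?case using Cons unfolding general_steps_def s by fastforce
qed

lemma finite_SG: "finite (SG n)"
proof (rule finite_subset)
  show "SG n \<subseteq> {\<pi>. set \<pi> \<subseteq> {..n} \<times> {..n} \<and> length \<pi> \<le> n + n}"
  proof
    fix \<pi> assume "\<pi> \<in> SG n"
    then have "general_steps \<pi>" "sum_list \<pi> = (n, n)"
      by (auto simp: SG_def vertex_def simp flip: zero_prod_def)
    then show "\<pi> \<in> {\<pi>. set \<pi> \<subseteq> {..n} \<times> {..n} \<and> length \<pi> \<le> n + n}"
      using general_steps_bounds[of \<pi>] by auto
  qed
  show "finite {\<pi>. set \<pi> \<subseteq> {..n} \<times> {..n} \<and> length \<pi> \<le> n + n}"
    by (intro finite_lists_length_le) auto
qed

end

theory Submission
  imports Defs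
begin

text \<open>A subdiagonal path is described by the heights \<open>x - y\<close> of its vertices above the diagonal.
  A vertex is active iff it lies on the diagonal or the first later vertex that is at most as high
  has the same height. A nonempty subdiagonal path \<open>\<pi>\<close> is decomposed according to its first step.
  If that step is \<open>(i + 1, j + 1)\<close>, replace it by \<open>(i, j)\<close>. If it is \<open>(i + 1, 0)\<close>, let
  \<open>j + 1\<close> be the least positive height before the first return to the diagonal and \<open>V\<close> the last
  such vertex of that height; split \<open>\<pi>\<close> at \<open>V\<close>, replace the first step by \<open>(i, j)\<close>, and shorten
  by \<open>j + 1\<close> the step returning to the diagonal. The pieces are shorter subdiagonal paths, possibly
  beginning with the null step, and the presence of the null step records whether the initial column
  of the piece is active in \<open>\<pi>\<close>. All other columns keep their status. Hence the numbers \<open>c m\<close> of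
  paths with a prescribed active set satisfy \<open>c (m + 1) = c m + (\<Sum>p\<le>m. c p * c (m - p))\<close>,
  whatever the set is.\<close>

section \<open>Heights and first returns\<close>

fun width :: "point list \<Rightarrow> nat" where
  "width [] = 0"
| "width ((i, j) # \<rho>) = i + width \<rho>"

text \<open>Subdiagonality of a path from height \<open>h\<close> to the diagonal; the guard keeps
  the truncated subtraction exact.\<close>

fun descent :: "nat \<Rightarrow> point list \<Rightarrow> bool" where
  "descent h [] \<longleftrightarrow> h = 0"
| "descent h ((i, j) # \<rho>) \<longleftrightarrow> j \<le> h + i \<and> descent (h + i - j) \<rho>"

text \<open>A first-return form of the search for a balanced subdiagonal subpath; \<open>d\<close>
  is the current height relative to the vertex under test.\<close>

fun returns :: "nat \<Rightarrow> point list \<Rightarrow> bool" where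
  "returns d [] \<longleftrightarrow> False"
| "returns d ((i, j) # \<rho>) \<longleftrightarrow> d + i = j \<or> (j < d + i \<and> returns (d + i - j) \<rho>)"

text \<open>The terminal vertex does not contribute.\<close>

fun act :: "nat \<Rightarrow> nat \<Rightarrow> point list \<Rightarrow> nat set" where
  "act x h [] = {}"
| "act x h ((i, j) # \<rho>) =
     (if h = 0 \<or> returns 0 ((i, j) # \<rho>) then {x} else {}) \<union> act (x + i) (h + i - j) \<rho>"

text \<open>In \<open>drops \<delta> d \<rho>\<close>, and likewise for \<open>extend\<close> and \<open>cut\<close>, heights are relative to a reference
  vertex at height \<open>\<delta>\<close>, and \<open>d\<close> is the current one: the first vertex of \<open>\<rho>\<close> not above the
  reference vertex lies on the diagonal. A leading null step of a path becomes under
  \<open>extend \<delta> 0\<close> the vertical step from the reference vertex to the diagonal.\<close>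

fun drops :: "nat \<Rightarrow> nat \<Rightarrow> point list \<Rightarrow> bool" where
  "drops \<delta> d [] \<longleftrightarrow> False"
| "drops \<delta> d ((i, j) # \<rho>) \<longleftrightarrow> d + i + \<delta> = j \<or> (j < d + i \<and> drops \<delta> (d + i - j) \<rho>)"

fun extend :: "nat \<Rightarrow> nat \<Rightarrow> point list \<Rightarrow> point list" where
  "extend \<delta> d [] = []"
| "extend \<delta> d ((i, j) # \<rho>) =
     (if d + i = j then (i, j + \<delta>) # \<rho> else (i, j) # extend \<delta> (d + i - j) \<rho>)"

fun cut :: "nat \<Rightarrow> nat \<Rightarrow> point list \<Rightarrow> point list" where
  "cut \<delta> d [] = []"
| "cut \<delta> d ((i, j) # \<rho>) =
     (if d + i + \<delta> = j then (i, j - \<delta>) # \<rho> else (i, j) # cut \<delta> (d + i - j) \<rho>)"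

section \<open>Lifting, extending and cutting paths\<close>

lemma width_append [simp]: "width (\<alpha> @ \<beta>) = width \<alpha> + width \<beta>"
  by (induction \<alpha> rule: width.induct) auto

lemma width_extend [simp]: "width (extend \<delta> d \<tau>) = width \<tau>"
  by (induction \<tau> arbitrary: d rule: width.induct) auto

lemma width_cut [simp]: "width (cut \<delta> d \<tau>) = width \<tau>"
  by (induction \<tau> arbitrary: d rule: width.induct) auto

text \<open>Lifted by \<open>\<delta>\<close>, the part \<open>\<alpha>\<close> stays at height at
  least \<open>\<delta>\<close> and ends there.\<close>

lemma descent_append:
  "descent e \<alpha> \<Longrightarrow> descent (e + \<delta>) (\<alpha> @ \<kappa>) \<longleftrightarrow> descent \<delta> \<kappa>"
proof (induction e \<alpha> rule: descent.induct)
  case (2 h i j \<rho>)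
  then have "h + \<delta> + i - j = h + i - j + \<delta>" by auto
  with 2 show ?case by auto
qed auto

text \<open>The first step of \<open>\<tau>\<close> that reaches height \<open>0\<close> absorbs the
  lift by \<open>\<delta>\<close>; from there on the heights are the old ones.\<close>

lemma descent_extend:
  "descent d \<tau> \<Longrightarrow> \<tau> \<noteq> [] \<Longrightarrow> descent (d + \<delta>) (extend \<delta> d \<tau>)"
proof (induction d \<tau> rule: descent.induct)
  case (2 h i j \<rho>)
  then have "h + \<delta> + i - j = h + i - j + \<delta>" by auto
  with 2 show ?case by (cases \<rho>) auto
qed auto

lemma drops_extend:
  "descent d \<tau> \<Longrightarrow> \<tau> \<noteq> [] \<Longrightarrow> drops \<delta> d (extend \<delta> d \<tau>)"
proof (induction d \<tau> rule: descent.induct)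
  case (2 h i j \<rho>)
  then show ?case by (cases \<rho>) auto
qed auto

text \<open>Before the first return \<open>j < d + i\<close>, so no earlier step passes the test
  \<open>d + i + \<delta> = j\<close>, and \<open>cut\<close> finds exactly the lengthened
  step.\<close>

lemma cut_extend:
  "descent d \<tau> \<Longrightarrow> 0 < \<delta> \<Longrightarrow> cut \<delta> d (extend \<delta> d \<tau>) = \<tau>"
  by (induction d \<tau> rule: descent.induct) auto

lemma extend_cut:
  "drops \<delta> d \<kappa> \<Longrightarrow> 0 < \<delta> \<Longrightarrow> extend \<delta> d (cut \<delta> d \<kappa>) = \<kappa>"
  by (induction \<delta> d \<kappa> rule: drops.induct) auto

lemma descent_cut:
  "drops \<delta> d \<kappa> \<Longrightarrow> 0 < \<delta> \<Longrightarrow> descent (d + \<delta>) \<kappa> \<Longrightarrow> descent d (cut \<delta> d \<kappa>)"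
proof (induction \<delta> d \<kappa> rule: drops.induct)
  case (2 \<delta> d i j \<rho>)
  then have "j < d + i \<Longrightarrow> d + \<delta> + i - j = d + i - j + \<delta>" by auto
  with 2 show ?case by auto
qed auto

text \<open>The shortened step satisfies \<open>j - \<delta> = d + i\<close>, which is positive. So
  cutting can create a null step only at the head, starting from \<open>d = 0\<close>.\<close>

lemma nonzero_steps_cut:
  "drops \<delta> d \<kappa> \<Longrightarrow> 0 < d \<Longrightarrow> (0, 0) \<notin> set \<kappa> \<Longrightarrow> (0, 0) \<notin> set (cut \<delta> d \<kappa>)"
  by (induction \<delta> d \<kappa> rule: drops.induct) auto

lemma nonzero_steps_extend:
  "0 < \<delta> \<Longrightarrow> (0, 0) \<notin> set \<tau> \<Longrightarrow> (0, 0) \<notin> set (extend \<delta> d \<tau>)"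
  by (induction \<tau> arbitrary: d rule: width.induct) auto

lemma nonzero_steps_extend_tl:
  assumes "0 < \<delta>" "(0, 0) \<notin> set (tl \<tau>)"
  shows "(0, 0) \<notin> set (extend \<delta> 0 \<tau>)"
  using assms by (cases \<tau> rule: width.cases) (auto simp: nonzero_steps_extend)

lemma nonzero_steps_cut_tl:
  assumes "drops \<delta> 0 \<kappa>" "(0, 0) \<notin> set \<kappa>"
  shows "(0, 0) \<notin> set (tl (cut \<delta> 0 \<kappa>))"
  using assms by (cases \<kappa> rule: width.cases) (auto simp: nonzero_steps_cut)

section \<open>The last minimum before the first return\<close>

lemma drops_append_above:
  "descent e \<alpha> \<Longrightarrow> drops (h + t) 0 \<kappa> \<Longrightarrow> 0 < t \<Longrightarrow> drops h (e + t) (\<alpha> @ \<kappa>)"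
proof (induction e \<alpha> rule: descent.induct)
  case (1 e)
  \<comment> \<open>The reference vertex is lowered by \<open>t\<close>: earlier vertices stay above
    it, and the drop by \<open>h + t\<close> below the old one is a drop by \<open>h\<close> below
    the new one.\<close>
  have "drops (h + t) d \<kappa> \<Longrightarrow> drops h (d + t) \<kappa>" for d
  proof (induction "h + t" d \<kappa> rule: drops.induct)
    case (2 d i j \<rho>)
    then have "j < d + i \<Longrightarrow> d + t + i - j = d + i - j + t" by auto
    with 2 show ?case by auto
  qed auto
  from this[of 0] 1 show ?case by simp
next
  case (2 e i j \<rho>)
  then have "e + t + i - j = e + i - j + t" by auto
  with 2 show ?case by auto
qed

text \<open>The cut point is the last vertex of minimal positive height before the first return
  to height \<open>0\<close>.\<close>

lemma last_minimum_exists: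
  assumes "descent h \<rho>" "0 < h"
  shows "\<exists>\<alpha> \<kappa> \<delta>. \<rho> = \<alpha> @ \<kappa> \<and> 0 < \<delta> \<and> \<delta> \<le> h \<and> descent (h - \<delta>) \<alpha> \<and> drops \<delta> 0 \<kappa>"
  using assms
proof (induction h \<rho> rule: descent.induct)
  case (2 h i j \<rho>)
  show ?case
  proof (cases "h + i = j")
    case True
    with 2 show ?thesis
      by (intro exI[of _ "[]"] exI[of _ "(i, j) # \<rho>"] exI[of _ h]) auto
  next
    case False
    with 2 obtain \<alpha> \<kappa> \<delta> where d: "\<rho> = \<alpha> @ \<kappa>" "0 < \<delta>" "\<delta> \<le> h + i - j"
      "descent (h + i - j - \<delta>) \<alpha>" "drops \<delta> 0 \<kappa>"
      by auto
    show ?thesis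
    proof (cases "\<delta> \<le> h")
      case True
      then have "h - \<delta> + i - j = h + i - j - \<delta>" by auto
      with True d show ?thesis
        by (intro exI[of _ "(i, j) # \<alpha>"] exI[of _ \<kappa>] exI[of _ \<delta>]) auto
    next
      \<comment> \<open>Every later vertex before the return lies above height \<open>h\<close>, so
        the starting vertex is itself the last minimum: the prefix is empty and the cut height is
        \<open>h\<close>.\<close>
      case above: False
      then have "drops h (h + i - j - \<delta> + (\<delta> - h)) (\<alpha> @ \<kappa>)"
        using d by (intro drops_append_above) auto
      moreover have "h + i - j - \<delta> + (\<delta> - h) = i - j" using d above by auto
      ultimately have "drops h 0 ((i, j) # \<rho>)" using d above by auto
      with 2 show ?thesis
        by (intro exI[of _ "[]"] exI[of _ "(i, j) # \<rho>"] exI[of _ h]) auto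
    qed
  qed
qed auto

text \<open>Inside \<open>\<gamma>\<close> relative heights are at least \<open>-t\<close>, so the
  drop to \<open>-\<delta>\<close> cannot occur there. Every step of \<open>\<gamma>\<close> then
  ends above the reference vertex, although \<open>\<gamma>\<close> ends at
  \<open>-t\<close>.\<close>

lemma no_drop_inside:
  "drops \<delta> d (\<gamma> @ \<kappa>) \<Longrightarrow> \<gamma> \<noteq> [] \<Longrightarrow> descent (d + t) \<gamma> \<Longrightarrow> t < \<delta> \<Longrightarrow> False"
proof (induction \<gamma> arbitrary: d rule: width.induct)
  case (2 i j \<rho>)
  have "j < d + i" "drops \<delta> (d + i - j) (\<rho> @ \<kappa>)" using 2 by auto
  moreover from this have "d + t + i - j = d + i - j + t" by auto
  moreover from this have "descent (d + i - j + t) \<rho>" using 2(4) by simp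
  ultimately show ?case using "2.IH"[of "d + i - j"] 2(5) by (cases "\<rho> = []") auto
qed auto

text \<open>Two candidate cut points are compared, the second lying \<open>\<gamma>\<close> later.
  If \<open>\<delta>' \<le> \<delta>\<close>, a nonempty \<open>\<gamma>\<close> would lead from
  height \<open>\<delta>\<close> to the positive height \<open>\<delta>'\<close>, against
  \<open>no_drop_inside\<close>.\<close>

lemma last_minimum_unique_aux:
  assumes "descent (h - \<delta>) \<alpha>" "drops \<delta> 0 (\<gamma> @ \<kappa>)" "0 < \<delta>" "\<delta> \<le> h"
    and "descent (h - \<delta>') (\<alpha> @ \<gamma>)" "0 < \<delta>'" "\<delta>' \<le> h"
  shows "\<gamma> = []"
proof (rule ccontr)
  assume ne: "\<gamma> \<noteq> []"
  show False
  proof (cases "\<delta>' \<le> \<delta>")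
    case True
    then have eq: "h - \<delta>' = h - \<delta> + (\<delta> - \<delta>')" using assms(4) by linarith
    have "descent (0 + (\<delta> - \<delta>')) \<gamma>"
      using descent_append[OF assms(1), of "\<delta> - \<delta>'" \<gamma>] assms(5) unfolding eq by simp
    then show False using no_drop_inside[OF assms(2) ne, of "\<delta> - \<delta>'"] assms(3,6) by simp
  next
    case False
    \<comment> \<open>The prefix \<open>\<alpha>\<close> would end \<open>s\<close> below the floor
      that \<open>\<alpha> @ \<gamma>\<close> respects.\<close>
    have low: "descent (e + s) \<alpha> \<Longrightarrow> 0 < s \<Longrightarrow> descent e (\<alpha> @ \<gamma>) \<Longrightarrow> False" for e s
    proof (induction \<alpha> arbitrary: e rule: width.induct)
      case (2 i j \<rho>)
      then have "e + s + i - j = e + i - j + s" by auto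
      then have "descent (e + i - j + s) \<rho>" using 2(2) by simp
      then show ?case using "2.IH"[of "e + i - j"] 2(3,4) by simp
    qed auto
    have eq: "h - \<delta> = h - \<delta>' + (\<delta>' - \<delta>)" using False assms(7) by linarith
    have "0 < \<delta>' - \<delta>" using False by linarith
    from low[OF assms(1)[unfolded eq] this assms(5)] show False .
  qed
qed

lemma descent_unique: "descent a \<beta> \<Longrightarrow> descent b \<beta> \<Longrightarrow> a = b"
proof (induction a \<beta> arbitrary: b rule: descent.induct)
  case (2 h i j \<rho>)
  have "h + i - j = b + i - j" using 2(1)[of "b + i - j"] 2(2,3) by simp
  moreover have "j \<le> h + i" "j \<le> b + i" using 2(2,3) by simp_all
  ultimately show ?case by linarith
qed simp

lemma last_minimum_unique:
  assumes "\<alpha> @ \<kappa> = \<alpha>' @ \<kappa>'"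
    and "descent (h - \<delta>) \<alpha>" "drops \<delta> 0 \<kappa>" "0 < \<delta>" "\<delta> \<le> h"
    and "descent (h - \<delta>') \<alpha>'" "drops \<delta>' 0 \<kappa>'" "0 < \<delta>'" "\<delta>' \<le> h"
  shows "\<alpha> = \<alpha>' \<and> \<kappa> = \<kappa>' \<and> \<delta> = \<delta>'"
proof -
  have eq: "\<alpha> = \<alpha>' \<and> \<kappa> = \<kappa>'"
  proof -
    from assms(1) obtain \<gamma>
      where "\<alpha> = \<alpha>' @ \<gamma> \<and> \<gamma> @ \<kappa> = \<kappa>' \<or> \<alpha> @ \<gamma> = \<alpha>' \<and> \<kappa> = \<gamma> @ \<kappa>'"
      unfolding append_eq_append_conv2 by blast
    then show ?thesis
    proof
      assume *: "\<alpha> = \<alpha>' @ \<gamma> \<and> \<gamma> @ \<kappa> = \<kappa>'"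
      then have "\<gamma> = []"
        using last_minimum_unique_aux[of h \<delta>' \<alpha>' \<gamma> \<kappa> \<delta>] assms(2-9) by simp
      with * show ?thesis by simp
    next
      assume *: "\<alpha> @ \<gamma> = \<alpha>' \<and> \<kappa> = \<gamma> @ \<kappa>'"
      then have "\<gamma> = []"
        using last_minimum_unique_aux[of h \<delta> \<alpha> \<gamma> \<kappa>' \<delta>'] assms(2-9) by simp
      with * show ?thesis by simp
    qed
  qed
  have "h - \<delta> = h - \<delta>'"
    using descent_unique[of "h - \<delta>" \<alpha> "h - \<delta>'"] assms(2,6) eq by simp
  then show ?thesis using eq assms by auto
qed

section \<open>Activity under concatenation and extension\<close>

lemma returns_append:
  "descent d \<alpha> \<Longrightarrow> 0 < e \<Longrightarrow> e \<le> d \<Longrightarrow> returns (d - e) (\<alpha> @ \<kappa>) \<longleftrightarrow> returns (d - e) \<alpha>"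
proof (induction d \<alpha> rule: descent.induct)
  case (2 h i j \<rho>)
  \<comment> \<open>As \<open>e\<close> is positive, \<open>\<alpha>\<close> ends below the
    reference vertex, so the first vertex not above the latter is met within
    \<open>\<alpha>\<close>.\<close>
  show ?case
  proof (cases "j < h - e + i")
    case True
    then have "h - e + i - j = h + i - j - e" "e \<le> h + i - j" using 2(4) by simp_all
    then show ?thesis using 2 True by simp
  qed auto
qed auto

lemma returns_zero_append:
  "descent d \<alpha> \<Longrightarrow> \<alpha> \<noteq> [] \<Longrightarrow> returns d (\<alpha> @ \<kappa>)"
proof (induction d \<alpha> rule: descent.induct)
  case (2 h i j \<rho>)
  then show ?case by (cases \<rho>) auto
qed auto

text \<open>A vertex above the final height of \<open>\<alpha>\<close> has its test decided inside
  \<open>\<alpha>\<close>. A nonterminal vertex at that height counts as diagonal in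
  \<open>act x e \<alpha>\<close>; in the concatenation it is active because \<open>\<alpha>\<close>
  returns to it.\<close>

lemma act_append:
  "descent e \<alpha> \<Longrightarrow> act x (e + \<delta>) (\<alpha> @ \<kappa>) = act x e \<alpha> \<union> act (x + width \<alpha>) \<delta> \<kappa>"
proof (induction e \<alpha> arbitrary: x rule: descent.induct)
  case (2 e i j \<rho>)
  have IH: "act (x + i) (e + i - j + \<delta>) (\<rho> @ \<kappa>) =
      act (x + i) (e + i - j) \<rho> \<union> act (x + i + width \<rho>) \<delta> \<kappa>"
    using 2 by auto
  have "e + \<delta> + i - j = e + i - j + \<delta>" using 2 by auto
  moreover have "returns 0 (((i, j) # \<rho>) @ \<kappa>)" if "e = 0"
    using returns_zero_append[of 0 "(i, j) # \<rho>"] 2 that by auto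
  moreover have "returns 0 (((i, j) # \<rho>) @ \<kappa>) = returns 0 ((i, j) # \<rho>)" if "e > 0"
    using returns_append[of e "(i, j) # \<rho>" e \<kappa>] 2 that by auto
  ultimately show ?case using IH by (auto simp: add.assoc simp del: returns.simps)
qed auto

text \<open>The reference vertex has height \<open>e > 0\<close>, so a step reaching height
  \<open>0\<close> passes below it; lengthening that step neither creates nor destroys a
  return.\<close>

lemma returns_extend:
  "descent d \<tau> \<Longrightarrow> 0 < \<delta> \<Longrightarrow> 0 < e \<Longrightarrow> e \<le> d \<Longrightarrow>
     returns (d - e) (extend \<delta> d \<tau>) \<longleftrightarrow> returns (d - e) \<tau>"
proof (induction d \<tau> rule: descent.induct)
  case (2 h i j \<rho>)
  show ?case
  proof (cases "j < h - e + i")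
    case True
    then have "h - e + i - j = h + i - j - e" "e \<le> h + i - j" "h + i \<noteq> j" using 2 by simp_all
    then show ?thesis using 2 True by simp
  next
    case False
    then have "h - e + i \<noteq> j + \<delta>" "h - e + i \<noteq> j" if "h + i = j" using 2(3,4,5) that by auto
    then show ?thesis using False by auto
  qed
qed auto

text \<open>The first vertex not above the reference vertex now lies \<open>\<delta>\<close> below
  it.\<close>

lemma not_returns_extend:
  "descent d \<tau> \<Longrightarrow> 0 < \<delta> \<Longrightarrow> \<not> returns d (extend \<delta> d \<tau>)"
  by (induction d \<tau> rule: descent.induct) auto

lemma act_extend:
  "descent d \<tau> \<Longrightarrow> 0 < \<delta> \<Longrightarrow> 0 < d \<Longrightarrow> act x (d + \<delta>) (extend \<delta> d \<tau>) = act x d \<tau>"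
proof (induction d \<tau> arbitrary: x rule: descent.induct)
  case (2 d i j \<rho>)
  have "returns 0 (extend \<delta> d ((i, j) # \<rho>)) = returns 0 ((i, j) # \<rho>)"
    using returns_extend[of d "(i, j) # \<rho>" \<delta> d] 2 by auto
  moreover have "d + \<delta> + i - j = d + i - j + \<delta>" using 2 by auto
  ultimately show ?case using 2 by (auto split: if_splits)
qed auto

lemma act_bounds:
  "descent d \<tau> \<Longrightarrow> (0, 0) \<notin> set \<tau> \<Longrightarrow> act x d \<tau> \<subseteq> {x..<x + width \<tau>}"
proof (induction d \<tau> arbitrary: x rule: descent.induct)
  case (2 d i j \<rho>)
  have "act (x + i) (d + i - j) \<rho> \<subseteq> {x..<x + width ((i, j) # \<rho>)}"
    using 2(1)[of "x + i"] 2(2,3) by fastforce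
  \<comment> \<open>An active vertex is followed by a step of positive width, since a vertical step
    would lead below it or below the diagonal. This excludes the terminal column.\<close>
  moreover have "0 < i" if "d = 0 \<or> returns 0 ((i, j) # \<rho>)" using 2 that by (cases i) auto
  ultimately show ?case by auto
qed auto

text \<open>The starting vertex is omitted: it either disappears with the change of the first step
  or is made inactive by \<open>extend\<close>. Its column can still count through another
  vertex.\<close>

fun act_tl :: "nat \<Rightarrow> point list \<Rightarrow> nat set" where
  "act_tl x [] = {}"
| "act_tl x ((i, j) # \<rho>) = act (x + i) (i - j) \<rho>"

lemma act_tl_bounds:
  assumes "descent 0 \<tau>" "(0, 0) \<notin> set (tl \<tau>)"
  shows "act_tl x \<tau> \<subseteq> {x..<x + width \<tau>}"
proof (cases \<tau> rule: width.cases)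
  case (2 i j \<rho>)
  then show ?thesis using assms act_bounds[of "i - j" \<rho> "x + i"] by fastforce
qed auto

lemma act_extend_zero:
  assumes "descent 0 \<tau>" "0 < \<delta>"
  shows "act x \<delta> (extend \<delta> 0 \<tau>) = act_tl x \<tau>"
proof (cases \<tau> rule: width.cases)
  case (2 i j \<rho>)
  show ?thesis
  proof (cases "i = j")
    case True
    then show ?thesis using assms 2 by simp
  next
    case False
    then have eq: "\<delta> + i - j = i - j + \<delta>" and ne: "i \<noteq> j" and pos: "0 < i - j"
      and desc: "descent (i - j) \<rho>"
      using assms 2 by simp_all
    have "\<not> returns 0 (extend \<delta> 0 \<tau>)" using not_returns_extend[of 0 \<tau> \<delta>] assms by simp
    then have "act x \<delta> (extend \<delta> 0 \<tau>) = act (x + i) (\<delta> + i - j) (extend \<delta> (i - j) \<rho>)"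
      using 2 ne assms(2) by auto
    also have "\<dots> = act_tl x \<tau>"
      unfolding eq using act_extend[OF desc assms(2) pos, of "x + i"] 2 by simp
    finally show ?thesis .
  qed
qed simp

section \<open>Marked paths\<close>

definition SGw :: "nat \<Rightarrow> point list set" where
  "SGw m = {\<pi>. (0, 0) \<notin> set \<pi> \<and> descent 0 \<pi> \<and> width \<pi> = m}"

text \<open>The offset \<open>x\<close> lets the pieces of a path keep their column numbers, so that
  all are compared with the same \<open>S\<close>.\<close>

definition SGact :: "nat \<Rightarrow> nat \<Rightarrow> nat set \<Rightarrow> point list set" where
  "SGact x m S = {\<pi> \<in> SGw m. act x 0 \<pi> \<inter> {x<..<x + m} = S \<inter> {x<..<x + m}}"

text \<open>The head of a marked path may be the null step. It encodes that the initial column is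
  active, which a path starting on the diagonal cannot express by itself.\<close>

definition marked :: "point list \<Rightarrow> bool" where
  "marked \<tau> \<longleftrightarrow> \<tau> \<noteq> [] \<and> (0, 0) \<notin> set (tl \<tau>) \<and> descent 0 \<tau>"

text \<open>Column \<open>x\<close> is included because the initial column of a piece of positive
  width is interior to the whole path.\<close>

definition marked_act :: "nat \<Rightarrow> nat \<Rightarrow> nat set \<Rightarrow> point list set" where
  "marked_act x m S = {\<tau>. marked \<tau> \<and> width \<tau> = m \<and> act_tl x \<tau> \<inter> {x..<x + m} = S \<inter> {x..<x + m}}"

lemma act_zero_eq:
  "act x 0 ((i, j) # \<rho>) = insert x (act_tl x ((i, j) # \<rho>))"
  by simp

lemma width_0_eq_Nil: "descent 0 \<pi> \<Longrightarrow> (0, 0) \<notin> set \<pi> \<Longrightarrow> width \<pi> = 0 \<Longrightarrow> \<pi> = []"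
  by (cases \<pi> rule: width.cases) auto

lemma marked_act_0: "marked_act x 0 S = {[(0, 0)]}"
proof (intro equalityI subsetI)
  fix \<tau> assume t: "\<tau> \<in> marked_act x 0 S"
  then have "\<tau> \<noteq> []" by (simp add: marked_act_def marked_def)
  then obtain i j \<rho> where r: "\<tau> = (i, j) # \<rho>" by (cases \<tau> rule: width.cases) auto
  then have "i = 0" "j = 0" using t by (simp_all add: marked_act_def marked_def)
  then have "\<rho> = []" using t r width_0_eq_Nil[of \<rho>] by (simp add: marked_act_def marked_def)
  then show "\<tau> \<in> {[(0, 0)]}" using r \<open>i = 0\<close> \<open>j = 0\<close> by simp
qed (simp add: marked_act_def marked_def)

lemma SGw_0: "SGw 0 = {[]}"
proof (intro equalityI subsetI)
  fix \<pi> assume "\<pi> \<in> SGw 0"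
  then show "\<pi> \<in> {[]}" using width_0_eq_Nil[of \<pi>] by (simp add: SGw_def)
qed (simp add: SGw_def)

lemma SGact_0: "SGact x 0 S = {[]}"
  by (auto simp: SGact_def SGw_0)

lemma agree_split:
  assumes "0 < m"
  shows "A \<inter> {x..<x + m} = B \<inter> {x..<x + m} \<longleftrightarrow>
    (x \<in> A \<longleftrightarrow> x \<in> B) \<and> A \<inter> {x<..<x + m} = B \<inter> {x<..<x + (m::nat)}"
proof -
  have I: "{x..<x + m} = insert x {x<..<x + m}" using assms by auto
  have "x \<notin> {x<..<x + m}" by simp
  then show ?thesis unfolding I
    by (cases "x \<in> A"; cases "x \<in> B") (auto simp: Int_insert_right insert_ident)
qed

text \<open>Since \<open>act_tl\<close> omits the starting vertex, activity of column
  \<open>x\<close> forces a first step of width \<open>0\<close>, hence the null step; deleting it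
  leaves an ordinary path.\<close>

lemma marked_act_active:
  assumes "0 < m" "x \<in> S"
  shows "marked_act x m S = (#) (0, 0) ` SGact x m S"
proof (intro equalityI subsetI)
  fix \<tau> assume t: "\<tau> \<in> marked_act x m S"
  then have act: "x \<in> act_tl x \<tau>" "act_tl x \<tau> \<inter> {x<..<x + m} = S \<inter> {x<..<x + m}"
    using assms by (simp_all add: marked_act_def marked_def agree_split)
  have "\<tau> \<noteq> []" using t by (simp add: marked_act_def marked_def)
  then obtain i j \<rho> where r: "\<tau> = (i, j) # \<rho>" by (cases \<tau> rule: width.cases) auto
  have "act (x + i) (i - j) \<rho> \<subseteq> {x + i..<x + i + width \<rho>}"
    using t r act_bounds[of "i - j" \<rho> "x + i"] by (simp add: marked_act_def marked_def)
  then have "i = 0" using act r by (cases i) auto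
  moreover from this have "j = 0" using t r by (simp add: marked_act_def marked_def)
  ultimately show "\<tau> \<in> (#) (0, 0) ` SGact x m S"
    using t r act by (simp add: marked_act_def marked_def SGact_def SGw_def)
next
  fix \<tau> assume "\<tau> \<in> (#) (0, 0) ` SGact x m S"
  then obtain \<rho> where r: "\<tau> = (0, 0) # \<rho>" "\<rho> \<in> SGact x m S" by auto
  then have "width \<rho> \<noteq> 0" using assms by (simp add: SGact_def SGw_def)
  then have "\<rho> \<noteq> []" by auto
  then have "x \<in> act x 0 \<rho>" by (cases \<rho> rule: width.cases) auto
  with r assms show "\<tau> \<in> marked_act x m S"
    by (simp add: marked_act_def marked_def SGact_def SGw_def agree_split)
qed

text \<open>A null first step would end on the diagonal in column \<open>x\<close> and, as
  \<open>m\<close> is positive, make \<open>x\<close> active. Conversely, an ordinary path leaves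
  column \<open>x\<close> at once.\<close>

lemma marked_act_inactive:
  assumes "0 < m" "x \<notin> S"
  shows "marked_act x m S = SGact x m S"
proof (intro equalityI subsetI)
  fix \<tau> assume t: "\<tau> \<in> marked_act x m S"
  then have act: "x \<notin> act_tl x \<tau>" "act_tl x \<tau> \<inter> {x<..<x + m} = S \<inter> {x<..<x + m}"
    using assms by (simp_all add: marked_act_def marked_def agree_split)
  have "\<tau> \<noteq> []" using t by (simp add: marked_act_def marked_def)
  then obtain i j \<rho> where r: "\<tau> = (i, j) # \<rho>" by (cases \<tau> rule: width.cases) auto
  have "(i, j) \<noteq> (0, 0)"
  proof
    assume *: "(i, j) = (0, 0)"
    then have "width \<rho> \<noteq> 0" using t r assms by (simp add: marked_act_def marked_def)
    then have "\<rho> \<noteq> []" by auto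
    then have "x \<in> act x 0 \<rho>" by (cases \<rho> rule: width.cases) auto
    with * r act show False by simp
  qed
  moreover have "(0, 0) \<notin> set \<rho>" using t r by (simp add: marked_act_def marked_def)
  ultimately have "(0, 0) \<notin> set \<tau>" using r by auto
  moreover have "act x 0 \<tau> \<inter> {x<..<x + m} = S \<inter> {x<..<x + m}"
    using act unfolding r act_zero_eq by simp
  ultimately show "\<tau> \<in> SGact x m S"
    using t by (simp add: marked_act_def marked_def SGact_def SGw_def)
next
  fix \<tau> assume t: "\<tau> \<in> SGact x m S"
  then have "width \<tau> \<noteq> 0" using assms by (simp add: SGact_def SGw_def)
  then have "\<tau> \<noteq> []" by auto
  then obtain i j \<rho> where r: "\<tau> = (i, j) # \<rho>" by (cases \<tau> rule: width.cases) auto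
  have "descent 0 \<tau>" "(0, 0) \<notin> set \<tau>" using t by (simp_all add: SGact_def SGw_def)
  then have "0 < i" unfolding r by auto
  moreover have "act (x + i) (i - j) \<rho> \<subseteq> {x + i..<x + i + width \<rho>}"
    using t r act_bounds[of "i - j" \<rho> "x + i"] by (simp add: SGact_def SGw_def)
  ultimately have "x \<notin> act_tl x \<tau>" using r by auto
  moreover have "act_tl x \<tau> \<inter> {x<..<x + m} = S \<inter> {x<..<x + m}"
    using t unfolding r SGact_def act_zero_eq by simp
  ultimately have "act_tl x \<tau> \<inter> {x..<x + m} = S \<inter> {x..<x + m}"
    using assms by (simp add: agree_split)
  with t r show "\<tau> \<in> marked_act x m S" by (simp add: marked_act_def marked_def SGact_def SGw_def)
qed

lemma card_marked_act: "card (marked_act x m S) = card (SGact x m S)"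
proof (cases "m = 0")
  case True
  then show ?thesis by (simp add: marked_act_0 SGact_0)
next
  case False
  then show ?thesis
    by (cases "x \<in> S") (simp_all add: marked_act_active marked_act_inactive card_image)
qed

section \<open>Active sets in terms of heights\<close>

lemma vertex_zero: "vertex (0, 0) \<pi> i = sum_list (take i \<pi>)"
  by (simp add: vertex_def flip: zero_prod_def)

lemma width_eq_fst_sum_list: "width \<pi> = fst (sum_list \<pi>)"
  by (induction \<pi> rule: width.induct) simp_all

lemma all_le_Suc_iff: "(\<forall>i\<le>Suc n. P i) \<longleftrightarrow> P 0 \<and> (\<forall>i\<le>n. P (Suc i))"
  by (metis Suc_le_mono le0 not0_implies_Suc)

lemma descent_iff:
  "descent h \<pi> \<longleftrightarrow> (\<forall>i\<le>length \<pi>. snd (sum_list (take i \<pi>)) \<le> h + fst (sum_list (take i \<pi>)))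
     \<and> h + fst (sum_list \<pi>) = snd (sum_list \<pi>)"
proof (induction h \<pi> rule: descent.induct)
  case (2 h i j \<rho>)
  have "(\<forall>l\<le>length \<rho>. j + snd (sum_list (take l \<rho>)) \<le> h + (i + fst (sum_list (take l \<rho>))))
      \<Longrightarrow> j \<le> h + i"
    by (auto dest: spec[of _ 0])
  then show ?case
    unfolding length_Cons all_le_Suc_iff by (auto simp: 2)
qed simp

lemma SG_eq_SGw: "SG n = SGw n"
proof -
  have "\<pi> \<in> SG n \<longleftrightarrow> \<pi> \<in> SGw n" for \<pi>
    by (cases "sum_list \<pi>")
      (auto simp: SG_def SGw_def general_steps_def vertex_zero subdiagonal_iff descent_iff
        width_eq_fst_sum_list)
  then show ?thesis by blast
qed

lemma ex_pos_iff_ex_Suc: "(\<exists>k>0. P k) \<longleftrightarrow> (\<exists>k. P (Suc k))"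
  by (metis gr0_conv_Suc)

lemma ex_nat_zero_or_pos: "(\<exists>k. P k) \<longleftrightarrow> P (0::nat) \<or> (\<exists>k>0. P k)"
  by (metis gr0I)

text \<open>The least admissible \<open>k\<close> gives the first vertex not above the reference
  vertex, which is where the recursion stops.\<close>

lemma returns_iff:
  "returns d \<rho> \<longleftrightarrow> (\<exists>k>0. k \<le> length \<rho> \<and> d + fst (sum_list (take k \<rho>)) = snd (sum_list (take k \<rho>)) \<and>
     (\<forall>l\<le>k. snd (sum_list (take l \<rho>)) \<le> d + fst (sum_list (take l \<rho>))))"
  (is "_ \<longleftrightarrow> (\<exists>k>0. ?R d \<rho> k)")
proof (induction d \<rho> rule: returns.induct)
  case (2 d i j \<rho>)
  have Suc: "?R d ((i, j) # \<rho>) (Suc k) \<longleftrightarrow> j \<le> d + i \<and> ?R (d + i - j) \<rho> k" for k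
  proof -
    have l: "j + b \<le> d + (i + a) \<longleftrightarrow> b \<le> d + i - j + a" if "j \<le> d + i" for a b
      using that by linarith
    have e: "d + (i + a) = j + b \<longleftrightarrow> d + i - j + a = b" if "j \<le> d + i" for a b
      using that by linarith
    show ?thesis
    proof (cases "j \<le> d + i")
      case True
      have "fst (sum_list (take (Suc n) ((i, j) # \<rho>))) = i + fst (sum_list (take n \<rho>))"
        "snd (sum_list (take (Suc n) ((i, j) # \<rho>))) = j + snd (sum_list (take n \<rho>))" for n
        by simp_all
      then show ?thesis
        unfolding all_le_Suc_iff l[OF True] e[OF True] using True
        by (simp only: l[OF True] e[OF True] length_Cons Suc_le_mono take_0 sum_list.Nil fst_zero
            snd_zero le0 simp_thms)
    next
      case False
      have "\<not> (\<forall>l\<le>Suc k. snd (sum_list (take l ((i, j) # \<rho>))) \<le> d + fst (sum_list (take l ((i, j) # \<rho>))))"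
        using False by (intro notI) (drule spec[of _ 1], simp)
      with False show ?thesis by (simp only: simp_thms)
    qed
  qed
  have "(\<exists>k>0. ?R d ((i, j) # \<rho>) k) \<longleftrightarrow> (\<exists>k. ?R d ((i, j) # \<rho>) (Suc k))"
    by (rule ex_pos_iff_ex_Suc)
  also have "\<dots> \<longleftrightarrow> j \<le> d + i \<and> (\<exists>k. ?R (d + i - j) \<rho> k)"
    unfolding Suc by (simp only: ex_simps)
  also have "(\<exists>k. ?R (d + i - j) \<rho> k) \<longleftrightarrow>
      ?R (d + i - j) \<rho> 0 \<or> (\<exists>k>0. ?R (d + i - j) \<rho> k)"
    by (rule ex_nat_zero_or_pos)
  also have "?R (d + i - j) \<rho> 0 \<longleftrightarrow> d + i - j = 0" by simp
  finally have "(\<exists>k>0. ?R d ((i, j) # \<rho>) k) \<longleftrightarrow>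
      j \<le> d + i \<and> (d + i - j = 0 \<or> (\<exists>k>0. ?R (d + i - j) \<rho> k))" .
  moreover have "returns d ((i, j) # \<rho>) \<longleftrightarrow>
      j \<le> d + i \<and> (d + i - j = 0 \<or> (\<exists>k>0. ?R (d + i - j) \<rho> k))"
  proof (cases "j < d + i")
    case True
    then have "d + i \<noteq> j" "d + i - j \<noteq> 0" "j \<le> d + i" by linarith+
    with True 2 show ?thesis unfolding returns.simps by blast
  next
    case False
    then show ?thesis by (cases "d + i = j") simp_all
  qed
  ultimately show ?case by blast
qed simp

lemma act_iff:
  "descent h \<rho> \<Longrightarrow> k \<in> act x h \<rho> \<longleftrightarrow> (\<exists>i<length \<rho>. k = x + fst (sum_list (take i \<rho>)) \<and>
     (snd (sum_list (take i \<rho>)) = h + fst (sum_list (take i \<rho>)) \<or> returns 0 (drop i \<rho>)))"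
proof (induction h \<rho> arbitrary: x rule: descent.induct)
  case (2 h i j \<rho>)
  have "k \<in> act (x + i) (h + i - j) \<rho> \<longleftrightarrow> (\<exists>l<length \<rho>.
      k = x + i + fst (sum_list (take l \<rho>)) \<and>
     (snd (sum_list (take l \<rho>)) = h + i - j + fst (sum_list (take l \<rho>)) \<or> returns 0 (drop l \<rho>)))"
    using 2 by simp
  moreover have "snd (sum_list (take l \<rho>)) = h + i - j + fst (sum_list (take l \<rho>)) \<longleftrightarrow>
      j + snd (sum_list (take l \<rho>)) = h + (i + fst (sum_list (take l \<rho>)))" for l
    using 2(2) by auto
  ultimately show ?case
    unfolding length_Cons Ex_less_Suc2 by (auto simp: add.assoc simp del: returns.simps)
qed simp

lemma active_vertex_iff:
  assumes "\<pi> \<in> SG n" "i \<le> length \<pi>"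
  shows "active_vertex \<pi> i \<longleftrightarrow>
    snd (sum_list (take i \<pi>)) = fst (sum_list (take i \<pi>)) \<or> returns 0 (drop i \<pi>)"
proof -
  have le: "snd (sum_list (take i \<pi>)) \<le> fst (sum_list (take i \<pi>))"
    using assms by (auto simp: SG_eq_SGw SGw_def descent_iff)
  have take: "take l (substeps \<pi> i j) = take l (drop i \<pi>)" if "l \<le> j - i" for l j
    using that by (simp add: substeps_def min_def)
  have len: "length (substeps \<pi> i j) = j - i" if "j \<le> length \<pi>" for j
    using that by (simp add: substeps_def)
  \<comment> \<open>The initial vertex \<open>v\<close> is arbitrary because balance and
    subdiagonality are invariant under translation.\<close>
  have returns: "returns 0 (drop i \<pi>) \<longleftrightarrow> (\<exists>j. i < j \<and> j \<le> length \<pi> \<and>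
      balanced v (substeps \<pi> i j) \<and> subdiagonal v (substeps \<pi> i j))" (is "?L \<longleftrightarrow> ?R") for v
  proof -
    have conv: "balanced v (substeps \<pi> i j) \<and> subdiagonal v (substeps \<pi> i j) \<longleftrightarrow>
        fst (sum_list (take (j - i) (drop i \<pi>))) = snd (sum_list (take (j - i) (drop i \<pi>))) \<and>
        (\<forall>l\<le>j - i. snd (sum_list (take l (drop i \<pi>))) \<le> fst (sum_list (take l (drop i \<pi>))))"
      if "j \<le> length \<pi>" for j
      using that by (auto simp: balanced_iff subdiagonal_iff vertex_def len take) (simp_all add: substeps_def)
    show ?thesis
    proof
      assume ?L
      then obtain k where k: "0 < k" "k \<le> length (drop i \<pi>)"
        "fst (sum_list (take k (drop i \<pi>))) = snd (sum_list (take k (drop i \<pi>)))"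
        "\<forall>l\<le>k. snd (sum_list (take l (drop i \<pi>))) \<le> fst (sum_list (take l (drop i \<pi>)))"
        unfolding returns_iff add_0 by blast
      then have "i + k \<le> length \<pi>" using assms(2) by simp
      then show ?R using conv[of "i + k"] k by (intro exI[of _ "i + k"]) simp
    next
      assume ?R
      then obtain j where j: "i < j" "j \<le> length \<pi>"
        "balanced v (substeps \<pi> i j) \<and> subdiagonal v (substeps \<pi> i j)"
        by blast
      then show ?L
        unfolding returns_iff add_0 using conv[OF j(2)] by (intro exI[of _ "j - i"]) simp
    qed
  qed
  show ?thesis
    unfolding active_vertex_def Let_def vertex_zero returns[of "sum_list (take i \<pi>)"]
    using le by auto
qed

lemma active_set_eq_act:
  assumes "\<pi> \<in> SG n" "1 \<le> n"
  shows "active_set n \<pi> = act 0 0 \<pi> \<inter> {0<..<n}"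
proof -
  have \<pi>: "descent 0 \<pi>" "fst (sum_list \<pi>) = n"
    using assms by (auto simp: SG_eq_SGw SGw_def width_eq_fst_sum_list)
  \<comment> \<open>The terminal vertex, omitted by \<open>act\<close>, lies in column
    \<open>n\<close>, outside the range of \<open>k\<close>.\<close>
  have "active_line \<pi> k \<longleftrightarrow> k \<in> act 0 0 \<pi>" if "k < n" for k
  proof -
    have "active_line \<pi> k \<longleftrightarrow>
        (\<exists>i<length \<pi>. fst (sum_list (take i \<pi>)) = k \<and> active_vertex \<pi> i)"
      using that \<pi>(2) unfolding active_line_def vertex_zero
      by (metis le_eq_less_or_eq nat_less_le take_all_iff order_refl)
    then show ?thesis
      unfolding act_iff[OF \<pi>(1)] using active_vertex_iff[OF assms(1)] by auto
  qed
  then show ?thesis using assms(2) unfolding active_set_def by auto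
qed

section \<open>Decomposition by the first step\<close>

lemma finite_SGact: "finite (SGact x m S)"
  using finite_SG[of m] by (auto simp: SGact_def SG_eq_SGw)

lemma finite_marked_act: "finite (marked_act x m S)"
proof (cases "m = 0")
  case True
  then show ?thesis by (simp add: marked_act_0)
next
  case False
  then show ?thesis
    by (cases "x \<in> S") (simp_all add: marked_act_active marked_act_inactive finite_SGact)
qed

fun raise :: "point list \<Rightarrow> point list" where
  "raise [] = []"
| "raise ((i, j) # \<rho>) = (Suc i, Suc j) # \<rho>"

text \<open>The coordinate \<open>j\<close> stores the cut height \<open>Suc j\<close>. For
  \<open>j \<le> i\<close> the height after the new first step is
  \<open>Suc i = (i - j) + Suc j\<close>, so for marked pieces \<open>\<alpha>\<close> ends at
  height \<open>Suc j\<close>.\<close>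

fun join :: "point list \<Rightarrow> point list \<Rightarrow> point list" where
  "join [] \<tau> = []"
| "join ((i, j) # \<alpha>) \<tau> = (Suc i, 0) # \<alpha> @ extend (Suc j) 0 \<tau>"

lemma marked_exhaust:
  assumes "marked \<tau>"
  obtains i j \<rho> where "\<tau> = (i, j) # \<rho>" "(0, 0) \<notin> set \<rho>" "j \<le> i" "descent (i - j) \<rho>"
  using assms by (cases \<tau> rule: width.cases) (simp_all add: marked_def)

lemma raise_in_SGw: "marked \<kappa> \<Longrightarrow> raise \<kappa> \<in> SGw (Suc (width \<kappa>))"
  by (erule marked_exhaust) (simp add: SGw_def)

lemma act_raise: "marked \<kappa> \<Longrightarrow> act x 0 (raise \<kappa>) = insert x (act_tl (Suc x) \<kappa>)"
  by (erule marked_exhaust) simp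

lemma raise_in_SGact_iff:
  assumes "marked \<kappa>"
  shows "raise \<kappa> \<in> SGact x (Suc (width \<kappa>)) S \<longleftrightarrow> \<kappa> \<in> marked_act (Suc x) (width \<kappa>) S"
proof -
  have "{x<..<x + Suc (width \<kappa>)} = {Suc x..<Suc x + width \<kappa>}" by auto
  then show ?thesis
    using assms by (simp add: SGact_def marked_act_def raise_in_SGw act_raise)
qed

lemma join_in_SGw:
  assumes "marked \<sigma>" "marked \<tau>"
  shows "join \<sigma> \<tau> \<in> SGw (Suc (width \<sigma> + width \<tau>))"
proof -
  obtain i j \<alpha> where s: "\<sigma> = (i, j) # \<alpha>" "(0, 0) \<notin> set \<alpha>" "j \<le> i" "descent (i - j) \<alpha>"
    using assms(1) by (rule marked_exhaust)
  have t: "(0, 0) \<notin> set (tl \<tau>)" "descent 0 \<tau>" "\<tau> \<noteq> []"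
    using assms(2) by (simp_all add: marked_def)
  have "descent (0 + Suc j) (extend (Suc j) 0 \<tau>)" using descent_extend[OF t(2,3)] .
  then have "descent (i - j + Suc j) (\<alpha> @ extend (Suc j) 0 \<tau>)"
    unfolding descent_append[OF s(4)] by simp
  moreover have "(0, 0) \<notin> set (extend (Suc j) 0 \<tau>)"
    using nonzero_steps_extend_tl[OF _ t(1), of "Suc j"] by simp
  ultimately show ?thesis using s by (simp add: SGw_def)
qed

lemma act_join:
  assumes "marked \<sigma>" "marked \<tau>"
  shows "act x 0 (join \<sigma> \<tau>) =
    insert x (act_tl (Suc x) \<sigma> \<union> act_tl (Suc x + width \<sigma>) \<tau>)"
proof -
  obtain i j \<alpha> where s: "\<sigma> = (i, j) # \<alpha>" "(0, 0) \<notin> set \<alpha>" "j \<le> i" "descent (i - j) \<alpha>"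
    using assms(1) by (rule marked_exhaust)
  have t: "descent 0 \<tau>" using assms(2) by (simp add: marked_def)
  have h: "Suc i = i - j + Suc j" using s(3) by linarith
  have "act (x + Suc i) (Suc i) (\<alpha> @ extend (Suc j) 0 \<tau>) =
      act (x + Suc i) (i - j) \<alpha> \<union> act (x + Suc i + width \<alpha>) (Suc j) (extend (Suc j) 0 \<tau>)"
    using act_append[OF s(4), of "x + Suc i" "Suc j" "extend (Suc j) 0 \<tau>"] unfolding h[symmetric] .
  also have "\<dots> = act_tl (Suc x) \<sigma> \<union> act_tl (Suc x + width \<sigma>) \<tau>"
    using act_extend_zero[OF t, of "Suc j"] s(1) by (simp add: add.assoc)
  finally show ?thesis using s(1) by simp
qed

lemma agree_union_iff:
  assumes "A \<subseteq> I" "B \<subseteq> J" "I \<inter> J = {}"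
  shows "(A \<union> B) \<inter> (I \<union> J) = S \<inter> (I \<union> J) \<longleftrightarrow> A \<inter> I = S \<inter> I \<and> B \<inter> J = S \<inter> J"
proof
  assume eq: "(A \<union> B) \<inter> (I \<union> J) = S \<inter> (I \<union> J)"
  have "A \<inter> I = (A \<union> B) \<inter> (I \<union> J) \<inter> I" "B \<inter> J = (A \<union> B) \<inter> (I \<union> J) \<inter> J"
    using assms by auto
  then show "A \<inter> I = S \<inter> I \<and> B \<inter> J = S \<inter> J" unfolding eq by auto
next
  assume "A \<inter> I = S \<inter> I \<and> B \<inter> J = S \<inter> J"
  moreover have "(A \<union> B) \<inter> (I \<union> J) = A \<inter> I \<union> B \<inter> J" using assms by auto
  ultimately show "(A \<union> B) \<inter> (I \<union> J) = S \<inter> (I \<union> J)" by (simp add: Int_Un_distrib)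
qed

lemma join_in_SGact_iff:
  assumes "marked \<sigma>" "marked \<tau>"
  shows "join \<sigma> \<tau> \<in> SGact x (Suc (width \<sigma> + width \<tau>)) S \<longleftrightarrow>
    \<sigma> \<in> marked_act (Suc x) (width \<sigma>) S \<and> \<tau> \<in> marked_act (Suc x + width \<sigma>) (width \<tau>) S"
proof -
  \<comment> \<open>The column of the cut vertex is assigned to \<open>\<tau>\<close>, which makes
    the conditions on the two pieces independent.\<close>
  define I J where "I = {Suc x..<Suc x + width \<sigma>}"
    and "J = {Suc x + width \<sigma>..<Suc x + width \<sigma> + width \<tau>}"
  have IJ: "{x<..<x + Suc (width \<sigma> + width \<tau>)} = I \<union> J" "x \<notin> I \<union> J" "I \<inter> J = {}"
    unfolding I_def J_def by auto
  have sub: "act_tl (Suc x) \<sigma> \<subseteq> I" "act_tl (Suc x + width \<sigma>) \<tau> \<subseteq> J"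
    using act_tl_bounds[of \<sigma> "Suc x"] act_tl_bounds[of \<tau> "Suc x + width \<sigma>"] assms
    unfolding I_def J_def marked_def by blast+
  have "act x 0 (join \<sigma> \<tau>) \<inter> (I \<union> J) =
      (act_tl (Suc x) \<sigma> \<union> act_tl (Suc x + width \<sigma>) \<tau>) \<inter> (I \<union> J)"
    using IJ(2) unfolding act_join[OF assms] by simp
  then show ?thesis
    unfolding SGact_def marked_act_def mem_Collect_eq IJ(1) using assms agree_union_iff[OF sub IJ(3), of S]
    by (simp add: join_in_SGw I_def J_def)
qed

lemma SGw_Suc_cases:
  assumes "\<pi> \<in> SGw (Suc m)"
  obtains (raise) \<kappa> where "marked \<kappa>" "width \<kappa> = m" "\<pi> = raise \<kappa>"
  | (join) \<sigma> \<tau> where "marked \<sigma>" "marked \<tau>" "width \<sigma> + width \<tau> = m" "\<pi> = join \<sigma> \<tau>"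
proof -
  have "\<pi> \<noteq> []" using assms by (auto simp: SGw_def)
  then obtain i j \<rho> where p: "\<pi> = (i, j) # \<rho>" by (cases \<pi> rule: width.cases) auto
  have pr: "(0, 0) \<notin> set \<rho>" "j \<le> i" "(i, j) \<noteq> (0, 0)" "descent (i - j) \<rho>" "i + width \<rho> = Suc m"
    using assms by (auto simp: p SGw_def)
  then have "i \<noteq> 0" by auto
  then obtain i' where i: "i = Suc i'" using not0_implies_Suc by auto
  show ?thesis
  proof (cases j)
    case (Suc j')
    show ?thesis
      by (rule raise[of "(i', j') # \<rho>"]) (use pr i Suc p in \<open>simp_all add: marked_def\<close>)
  next
    \<comment> \<open>After the horizontal first step the tail descends from height
      \<open>i\<close>. The height \<open>\<delta>\<close> of its last minimum becomes
      \<open>Suc j'\<close>, and \<open>\<delta> \<le> i\<close> gives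
      \<open>j' \<le> i'\<close>.\<close>
    case 0
    then have "descent i \<rho>" using pr by simp
    then obtain \<alpha> \<kappa> \<delta> where d: "\<rho> = \<alpha> @ \<kappa>" "0 < \<delta>" "\<delta> \<le> i" "descent (i - \<delta>) \<alpha>" "drops \<delta> 0 \<kappa>"
      using last_minimum_exists i by blast
    obtain j' where j: "\<delta> = Suc j'" using d(2) gr0_conv_Suc by auto
    have "i - \<delta> + \<delta> = i" using d(3) by simp
    then have "descent (0 + \<delta>) \<kappa>"
      using descent_append[OF d(4), of \<delta> \<kappa>] \<open>descent i \<rho>\<close> d(1) by simp
    then have "descent 0 (cut \<delta> 0 \<kappa>)" by (rule descent_cut[OF d(5,2)])
    moreover have "(0, 0) \<notin> set (tl (cut \<delta> 0 \<kappa>))"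
      using pr d by (intro nonzero_steps_cut_tl) simp_all
    moreover have "cut \<delta> 0 \<kappa> \<noteq> []" using d(5) by (cases \<kappa> rule: width.cases) simp_all
    ultimately have t: "marked (cut \<delta> 0 \<kappa>)" by (simp add: marked_def)
    have s: "marked ((i', j') # \<alpha>)" using pr d i j by (simp add: marked_def)
    show ?thesis
    proof (rule join[OF s t])
      show "width ((i', j') # \<alpha>) + width (cut \<delta> 0 \<kappa>) = m" using pr d i by simp
      show "\<pi> = join ((i', j') # \<alpha>) (cut \<delta> 0 \<kappa>)"
        using p 0 i d(1) extend_cut[OF d(5,2)] j by simp
    qed
  qed
qed

lemma raise_inject:
  assumes "raise \<kappa> = raise \<kappa>'" "marked \<kappa>" "marked \<kappa>'"
  shows "\<kappa> = \<kappa>'"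
  by (rule marked_exhaust[OF assms(2)], rule marked_exhaust[OF assms(3)]) (use assms(1) in simp)

text \<open>The first step rises in \<open>raise \<kappa>\<close> and is horizontal in
  \<open>join \<sigma> \<tau>\<close>.\<close>

lemma raise_neq_join:
  assumes "marked \<kappa>" "marked \<sigma>"
  shows "raise \<kappa> \<noteq> join \<sigma> \<tau>"
  by (rule marked_exhaust[OF assms(1)], rule marked_exhaust[OF assms(2)]) simp

lemma join_inject:
  assumes "join \<sigma> \<tau> = join \<sigma>' \<tau>'" "marked \<sigma>" "marked \<tau>" "marked \<sigma>'" "marked \<tau>'"
  shows "\<sigma> = \<sigma>' \<and> \<tau> = \<tau>'"
proof -
  obtain i j \<alpha> where s: "\<sigma> = (i, j) # \<alpha>" "j \<le> i" "descent (i - j) \<alpha>"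
    using assms(2) by (rule marked_exhaust)
  obtain i' j' \<alpha>' where s': "\<sigma>' = (i', j') # \<alpha>'" "j' \<le> i'" "descent (i' - j') \<alpha>'"
    using assms(4) by (rule marked_exhaust)
  have t: "descent 0 \<tau>" "\<tau> \<noteq> []" "descent 0 \<tau>'" "\<tau>' \<noteq> []"
    using assms by (simp_all add: marked_def)
  have i: "i' = i" and eq: "\<alpha> @ extend (Suc j) 0 \<tau> = \<alpha>' @ extend (Suc j') 0 \<tau>'"
    using assms(1) s(1) s'(1) by simp_all
  \<comment> \<open>Both sides cut the same tail, of starting height \<open>Suc i\<close>, at its
    last minimum.\<close>
  have "\<alpha> = \<alpha>' \<and> extend (Suc j) 0 \<tau> = extend (Suc j') 0 \<tau>' \<and> Suc j = Suc j'"
    using s s' i t by (intro last_minimum_unique[OF eq, of "Suc i"] drops_extend) simp_all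
  moreover from this have "\<tau> = \<tau>'"
    using cut_extend[OF t(1), of "Suc j"] cut_extend[OF t(3), of "Suc j"] by (metis zero_less_Suc)
  ultimately show ?thesis using s s' i by simp
qed

lemma SGact_Suc:
  "SGact x (Suc m) S = raise ` marked_act (Suc x) m S \<union>
     (\<lambda>(p, \<sigma>, \<tau>). join \<sigma> \<tau>) ` (SIGMA p:{..m}. marked_act (Suc x) p S \<times> marked_act (Suc x + p) (m - p) S)"
  (is "_ = ?A \<union> ?B")
proof (intro equalityI subsetI)
  fix \<pi> assume p: "\<pi> \<in> SGact x (Suc m) S"
  then have "\<pi> \<in> SGw (Suc m)" by (simp add: SGact_def)
  then show "\<pi> \<in> ?A \<union> ?B"
  proof (cases rule: SGw_Suc_cases)
    case (raise \<kappa>)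
    then have "\<kappa> \<in> marked_act (Suc x) m S" using p raise_in_SGact_iff[OF raise(1), of x S] by simp
    with raise show ?thesis by blast
  next
    case (join \<sigma> \<tau>)
    have "\<sigma> \<in> marked_act (Suc x) (width \<sigma>) S" "\<tau> \<in> marked_act (Suc x + width \<sigma>) (width \<tau>) S"
      using p join_in_SGact_iff[OF join(1,2), of x S] join(3,4) by simp_all
    moreover have "width \<sigma> \<le> m" "width \<tau> = m - width \<sigma>" using join(3) by simp_all
    ultimately have "(width \<sigma>, \<sigma>, \<tau>) \<in> (SIGMA p:{..m}. marked_act (Suc x) p S \<times> marked_act (Suc x + p) (m - p) S)"
      by simp
    then have "\<pi> \<in> ?B" using join(4) by (intro image_eqI[of _ _ "(width \<sigma>, \<sigma>, \<tau>)"]) simp_all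
    then show ?thesis ..
  qed
next
  fix \<pi> assume "\<pi> \<in> ?A \<union> ?B"
  then show "\<pi> \<in> SGact x (Suc m) S"
  proof
    assume "\<pi> \<in> ?A"
    then obtain \<kappa> where k: "\<kappa> \<in> marked_act (Suc x) m S" "\<pi> = raise \<kappa>" by blast
    then have "marked \<kappa>" "width \<kappa> = m" by (simp_all add: marked_act_def)
    with k show ?thesis using raise_in_SGact_iff[of \<kappa> x S] by simp
  next
    assume "\<pi> \<in> ?B"
    then obtain p \<sigma> \<tau> where st: "p \<le> m" "\<sigma> \<in> marked_act (Suc x) p S" "\<tau> \<in> marked_act (Suc x + p) (m - p) S"
      "\<pi> = join \<sigma> \<tau>"
      by auto
    then have "marked \<sigma>" "marked \<tau>" "width \<sigma> = p" "width \<tau> = m - p" by (simp_all add: marked_act_def)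
    with st show ?thesis using join_in_SGact_iff[of \<sigma> \<tau> x S] by simp
  qed
qed

section \<open>The counting recurrence\<close>

lemma card_SGact_Suc:
  "card (SGact x (Suc m) S) = card (SGact (Suc x) m S) +
     (\<Sum>p\<le>m. card (SGact (Suc x) p S) * card (SGact (Suc x + p) (m - p) S))"
proof -
  define \<Theta> where "\<Theta> = (SIGMA p:{..m}. marked_act (Suc x) p S \<times> marked_act (Suc x + p) (m - p) S)"
  have M: "marked \<tau>" "width \<tau> = p" if "\<tau> \<in> marked_act y p S" for \<tau> y p
    using that by (simp_all add: marked_act_def)
  have inj_raise: "inj_on raise (marked_act (Suc x) m S)"
    using M(1) raise_inject by (intro inj_onI) blast
  have inj_join: "inj_on (\<lambda>(p, \<sigma>, \<tau>). join \<sigma> \<tau>) \<Theta>"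
  proof (rule inj_onI)
    fix u v assume u: "u \<in> \<Theta>" and v: "v \<in> \<Theta>"
      and eq: "(\<lambda>(p, \<sigma>, \<tau>). join \<sigma> \<tau>) u = (\<lambda>(p, \<sigma>, \<tau>). join \<sigma> \<tau>) v"
    obtain p \<sigma> \<tau> where u': "u = (p, \<sigma>, \<tau>)" by (cases u)
    obtain p' \<sigma>' \<tau>' where v': "v = (p', \<sigma>', \<tau>')" by (cases v)
    have um: "marked \<sigma>" "width \<sigma> = p" "marked \<tau>" using u u' by (auto simp: \<Theta>_def dest: M)
    have vm: "marked \<sigma>'" "width \<sigma>' = p'" "marked \<tau>'" using v v' by (auto simp: \<Theta>_def dest: M)
    have "join \<sigma> \<tau> = join \<sigma>' \<tau>'" using eq u' v' by simp
    then have "\<sigma> = \<sigma>' \<and> \<tau> = \<tau>'" using join_inject um vm by blast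
    then show "u = v" using u' v' um(2) vm(2) by simp
  qed
  have disjoint: "raise ` marked_act (Suc x) m S \<inter> (\<lambda>(p, \<sigma>, \<tau>). join \<sigma> \<tau>) ` \<Theta> = {}"
    using raise_neq_join M(1) by (fastforce simp: \<Theta>_def)
  have "card (SGact x (Suc m) S) = card (marked_act (Suc x) m S) + card \<Theta>"
    unfolding SGact_Suc \<Theta>_def[symmetric]
    using card_image[OF inj_raise] card_image[OF inj_join] disjoint
    by (subst card_Un_disjoint) (simp_all add: \<Theta>_def finite_marked_act)
  also have "card \<Theta> = (\<Sum>p\<le>m. card (marked_act (Suc x) p S) * card (marked_act (Suc x + p) (m - p) S))"
    unfolding \<Theta>_def by (subst card_SigmaI) (simp_all add: finite_marked_act card_cartesian_product)
  finally show ?thesis by (simp add: card_marked_act)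
qed

text \<open>The recurrence involves the set and the offset only through counts for smaller widths,
  so strong induction with both arbitrary applies.\<close>

lemma card_SGact_independent: "card (SGact x m S) = card (SGact y m T)"
proof (induction m arbitrary: x y S T rule: less_induct)
  case (less m)
  show ?case
  proof (cases m)
    case 0
    then show ?thesis by (simp add: SGact_0)
  next
    case (Suc k)
    have "card (SGact (Suc x) p S) * card (SGact (Suc x + p) (k - p) S) =
        card (SGact (Suc y) p T) * card (SGact (Suc y + p) (k - p) T)" if "p \<le> k" for p
      using less[of p "Suc x" S "Suc y" T] less[of "k - p" "Suc x + p" S "Suc y + p" T] that Suc
      by simp
    then show ?thesis
      unfolding Suc card_SGact_Suc using less[of k "Suc x" S "Suc y" T] Suc by simp
  qed
qed

theorem theorem2:
  fixes n :: nat and S T :: "nat set"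
  assumes "n \<ge> 1" and "S \<subseteq> {1..n - 1}" and "T \<subseteq> {1..n - 1}"
  shows "card {\<pi> \<in> SG n. active_set n \<pi> = S} = card {\<pi> \<in> SG n. active_set n \<pi> = T}"
proof -
  have "{\<pi> \<in> SG n. active_set n \<pi> = U} = SGact 0 n U" if "U \<subseteq> {1..n - 1}" for U
  proof -
    have "U = U \<inter> {0<..<n}" using that assms(1) by fastforce
    then show ?thesis
      using active_set_eq_act[OF _ assms(1)] by (auto simp: SGact_def SG_eq_SGw)
  qed
  then show ?thesis using assms(2,3) card_SGact_independent by simp
qed

end
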